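(* For $n\geq 1$ and $0\leq k\leq n$, let $i_n^k(\emptyset;123)$ be the number of involutions of $\{1,\dots,n\}$ with exactly $k$ fixed points that contain the pattern $123$ exactly once. Then $i_n^3(\emptyset;123)=\frac{3}{n}\binom{n}{(n-3)/2}$ for $n\geq 3$ odd, and $i_n^k(\emptyset;123)=0$ in all other cases.
   Context: Permutations are in one-line notation. An involution is a permutation with $\pi^{-1}=\pi$; a fixed point is an $i$ with $\pi_i=i$. An occurrence of a pattern $\alpha\in S_m$ in $\pi\in S_n$ is a set of indices $i_1<\dots<i_m$ such that $\pi_{i_1}\cdots\pi_{i_m}$ is order-isomorphic to $\alpha$; $\pi$ contains $\alpha$ exactly once if there is exactly one such occurrence. *)

theory Defs
  imports Complex_Main "HOL-Combinatorics.Permutations"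
begin

definition order_isomorphic :: "nat list \<Rightarrow> nat list \<Rightarrow> bool" where
  "order_isomorphic xs ys \<longleftrightarrow> length xs = length ys \<and>
     (\<forall>i<length xs. \<forall>j<length xs. xs ! i < xs ! j \<longleftrightarrow> ys ! i < ys ! j)"

(* A permutation p of {1..n} is a function with "p permutes {1..n}"; a pattern is given by
   its one-line notation, as a list.  An occurrence is a set of positions: listed in
   increasing order i_1 < ... < i_m, they give the word p(i_1) ... p(i_m). *)
definition occurrences :: "nat \<Rightarrow> (nat \<Rightarrow> nat) \<Rightarrow> nat list \<Rightarrow> nat set set" where
  "occurrences n p \<alpha> =
     {I. I \<subseteq> {1..n} \<and> order_isomorphic (map p (sorted_list_of_set I)) \<alpha>}"

definition contains_once :: "nat \<Rightarrow> (nat \<Rightarrow> nat) \<Rightarrow> nat list \<Rightarrow> bool" where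
  "contains_once n p \<alpha> \<longleftrightarrow> (\<exists>!I. I \<in> occurrences n p \<alpha>)"

definition fixed_points :: "nat \<Rightarrow> (nat \<Rightarrow> nat) \<Rightarrow> nat set" where
  "fixed_points n p = {i \<in> {1..n}. p i = i}"

definition involutions :: "nat \<Rightarrow> (nat \<Rightarrow> nat) set" where
  "involutions n = {p. p permutes {1..n} \<and> inv p = p}"

definition num_involutions_once :: "nat \<Rightarrow> nat \<Rightarrow> nat list \<Rightarrow> nat" where
  "num_involutions_once n k \<alpha> =
     card {p \<in> involutions n. card (fixed_points n p) = k \<and> contains_once n p \<alpha>}"

end

theory Submission
  imports Defs
begin

text \<open>If an involution has a single occurrence of 123, its inverse yields the same occurrence, so the
  three positions \<open>i < m < k\<close> are fixed points; any three fixed points form an occurrence, so there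
  are no others. Every other position left of \<open>m\<close> has a value above \<open>m\<close> and vice versa, hence
  \<open>n = 2m - 1\<close>. The involution is determined by its values at positions \<open>m, ..., n\<close>. Following
  Burstein's splitting trick, replace there the value at \<open>m\<close> by \<open>i\<close> and the value at \<open>k\<close> by \<open>m\<close>:
  this gives exactly the 123-avoiding permutations of \<open>{1..m}\<close> that do not begin with \<open>m\<close>.
  These are counted by inserting the maximum, which in a 123-avoider must be preceded by a
  decreasing prefix; the numbers of avoiders with a decreasing prefix of given length are ballot
  numbers.\<close>

subsection \<open>Counting 123-avoiding words\<close>

text \<open>\<open>sorted_wrt\<close> quantifies over all pairs of entries in order, so it accepts a
  relation that is no ordering: the second conjunct forbids the triples that start at
  \<open>x\<close>.\<close>

fun avoids_123 :: "'a::linorder list \<Rightarrow> bool" where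
  "avoids_123 [] \<longleftrightarrow> True"
| "avoids_123 (x # xs) \<longleftrightarrow> avoids_123 xs \<and> sorted_wrt (\<lambda>y z. x < y \<longrightarrow> \<not> y < z) xs"

lemma sorted_wrt_map_upt:
  "sorted_wrt R (map f [a..<b]) \<longleftrightarrow> (\<forall>i j. a \<le> i \<and> i < j \<and> j < b \<longrightarrow> R (f i) (f j))"
proof -
  have "(\<forall>i j. i < j \<and> j < b - a \<longrightarrow> R (f (a + i)) (f (a + j))) \<longleftrightarrow>
        (\<forall>i j. a \<le> i \<and> i < j \<and> j < b \<longrightarrow> R (f i) (f j))" (is "?L = ?R")
  proof
    assume L: ?L
    show ?R
    proof (intro allI impI)
      fix i j assume "a \<le> i \<and> i < j \<and> j < b"
      then show "R (f i) (f j)" using L[rule_format, of "i - a" "j - a"] by (simp add: diff_less_mono)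
    qed
  qed auto
  then show ?thesis by (auto simp: sorted_wrt_iff_nth_less)
qed

lemma avoids_123_map_upt:
  "avoids_123 (map f [a..<b]) \<longleftrightarrow>
     (\<forall>i j k. a \<le> i \<and> i < j \<and> j < k \<and> k < b \<longrightarrow> \<not> (f i < f j \<and> f j < f k))"
proof (induction "b - a" arbitrary: a)
  case 0
  then show ?case by auto
next
  case (Suc d)
  then have "a < b" and "d = b - Suc a" by auto
  then have "avoids_123 (map f [a..<b]) \<longleftrightarrow>
      avoids_123 (map f [Suc a..<b]) \<and>
      (\<forall>j k. Suc a \<le> j \<and> j < k \<and> k < b \<longrightarrow> f a < f j \<longrightarrow> \<not> f j < f k)"
    by (simp add: upt_conv_Cons sorted_wrt_map_upt del: map_map)
  also have "\<dots> \<longleftrightarrow>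
     (\<forall>i j k. a \<le> i \<and> i < j \<and> j < k \<and> k < b \<longrightarrow> \<not> (f i < f j \<and> f j < f k))"
    unfolding Suc.hyps(1)[OF \<open>d = b - Suc a\<close>]
    using Suc_le_eq le_eq_less_or_eq less_trans by (smt (verit, best))
  finally show ?case .
qed

text \<open>A maximum can only be the last letter of a 123, so it does no harm exactly when no two
  letters before it rise.\<close>

lemma avoids_123_insert_max:
  assumes "\<forall>x \<in> set us \<union> set vs. x < m"
  shows "avoids_123 (us @ m # vs) \<longleftrightarrow> avoids_123 (us @ vs) \<and> sorted_wrt (\<ge>) us"
  using assms
proof (induction us)
  case Nil
  then have "\<forall>i<length vs. \<not> m < vs ! i" using nth_mem less_asym by fastforce
  then have "sorted_wrt (\<lambda>y z. m < y \<longrightarrow> \<not> y < z) vs"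
    by (auto simp: sorted_wrt_iff_nth_less)
  then show ?case by simp
next
  case (Cons x us)
  have *: "sorted_wrt (\<lambda>y z. x < y \<longrightarrow> \<not> y < z) (us @ m # vs) \<longleftrightarrow>
        sorted_wrt (\<lambda>y z. x < y \<longrightarrow> \<not> y < z) (us @ vs) \<and> (\<forall>u\<in>set us. x \<ge> u)"
  proof -
    have "(\<forall>u\<in>set us. x < u \<longrightarrow> \<not> u < m) \<longleftrightarrow> (\<forall>u\<in>set us. x \<ge> u)"
      using Cons.prems by (force simp: not_less[symmetric])
    moreover have "\<forall>v\<in>set vs. \<not> m < v"
      using Cons.prems by (meson UnI2 less_asym)
    ultimately show ?thesis by (auto simp: sorted_wrt_append)
  qed
  show ?case using Cons.IH Cons.prems by (auto simp: *)
qed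

text \<open>The parameter \<open>t\<close> makes the insertion recursion close: by
  \<open>avoids_123_insert_max\<close>, a new maximum may go to index \<open>s\<close> only behind a
  decreasing prefix of length \<open>s\<close>. As the words are distinct, \<ge> amounts to a strict
  decrease.\<close>

definition avoiders :: "nat \<Rightarrow> nat \<Rightarrow> nat list set" where
  "avoiders n t = {xs. distinct xs \<and> set xs = {1..n} \<and> avoids_123 xs \<and>
                       sorted_wrt (\<ge>) (take t xs)}"

section \<open>Avoiders grouped by the position of their maximum\<close>

definition insert_at :: "nat \<Rightarrow> 'a \<Rightarrow> 'a list \<Rightarrow> 'a list" where
  "insert_at s x xs = take s xs @ x # drop s xs"

lemma avoiders_length: "xs \<in> avoiders n t \<Longrightarrow> length xs = n"
  unfolding avoiders_def using distinct_card by fastforce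

lemma finite_avoiders [simp]: "finite (avoiders n t)"
proof (rule finite_subset)
  show "avoiders n t \<subseteq> {xs. set xs \<subseteq> {1..n} \<and> length xs = n}"
    using avoiders_length by (auto simp: avoiders_def)
qed (simp add: finite_lists_length_eq)

lemma insert_at_nth: "s \<le> length xs \<Longrightarrow> insert_at s x xs ! s = x"
  by (simp add: insert_at_def nth_append)

lemma inj_on_insert_at: "inj_on (insert_at s x) {xs. s \<le> length xs}"
proof (rule inj_onI)
  fix xs ys :: "'a list"
  assume "xs \<in> {xs. s \<le> length xs}" "ys \<in> {xs. s \<le> length xs}"
    and "insert_at s x xs = insert_at s x ys"
  then have "take s xs = take s ys \<and> drop s xs = drop s ys"
    by (auto simp: insert_at_def)
  then show "xs = ys" by (metis append_take_drop_id)
qed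

lemma card_insert_at_avoiders:
  assumes "s \<le> n"
  shows "card (insert_at s x ` avoiders n t) = card (avoiders n t)"
  using assms avoiders_length
  by (intro card_image inj_on_subset[OF inj_on_insert_at]) fastforce

lemma insert_at_mem_avoiders:
  assumes "s \<le> n" and "length xs = n"
  shows "insert_at s (Suc n) xs \<in> avoiders (Suc n) 0 \<longleftrightarrow> xs \<in> avoiders n s"
proof -
  define us vs where "us = take s xs" and "vs = drop s xs"
  then have xs: "xs = us @ vs" and ins: "insert_at s (Suc n) xs = us @ Suc n # vs"
    and take: "take s xs = us"
    by (auto simp: insert_at_def)
  have set: "distinct (us @ Suc n # vs) \<and> set (us @ Suc n # vs) = {1..Suc n} \<longleftrightarrow>
        distinct (us @ vs) \<and> set (us @ vs) = {1..n}" (is "?L \<longleftrightarrow> ?R")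
  proof
    assume L: ?L
    then have "set (us @ vs) = {1..Suc n} - {Suc n}" by auto
    also have "\<dots> = {1..n}" by auto
    finally show ?R using L by auto
  next
    assume R: ?R
    then have "Suc n \<notin> set (us @ vs)" by (metis Suc_n_not_le_n atLeastAtMost_iff)
    then have notin: "Suc n \<notin> set us" "Suc n \<notin> set vs" by auto
    have "set (us @ Suc n # vs) = insert (Suc n) (set (us @ vs))" by auto
    also have "\<dots> = {1..Suc n}" using R by auto
    finally show ?L using R notin by simp
  qed
  have "\<forall>x \<in> set us \<union> set vs. x < Suc n" if ?R
    using that unfolding set_append by auto
  then show ?thesis
    unfolding avoiders_def mem_Collect_eq ins take
    using set avoids_123_insert_max[of us vs "Suc n"] xs by auto
qed

lemma avoiders_max_at:
  assumes "s \<le> n"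
  shows "{xs \<in> avoiders (Suc n) 0. xs ! s = Suc n} = insert_at s (Suc n) ` avoiders n s"
proof (intro equalityI subsetI)
  fix xs assume xs: "xs \<in> {xs \<in> avoiders (Suc n) 0. xs ! s = Suc n}"
  define ys where "ys = take s xs @ drop (Suc s) xs"
  have len: "length xs = Suc n" using xs avoiders_length by blast
  have "xs = insert_at s (Suc n) ys" and "length ys = n"
    using xs len assms id_take_nth_drop[of s xs]
    by (auto simp: ys_def insert_at_def min_def)
  then show "xs \<in> insert_at s (Suc n) ` avoiders n s"
    using insert_at_mem_avoiders[OF assms, of ys] xs by auto
next
  fix xs assume "xs \<in> insert_at s (Suc n) ` avoiders n s"
  then show "xs \<in> {xs \<in> avoiders (Suc n) 0. xs ! s = Suc n}"
    using insert_at_mem_avoiders[OF assms] assms by (auto simp: avoiders_length insert_at_nth)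
qed

lemma avoiders_max_pos:
  assumes "xs \<in> avoiders (Suc n) t"
  obtains s where "s \<le> n" "xs ! s = Suc n"
proof -
  have "Suc n \<in> set xs" using assms by (auto simp: avoiders_def)
  then show ?thesis using that avoiders_length[OF assms] by (metis in_set_conv_nth less_Suc_eq_le)
qed

lemma avoiders_subset: "avoiders n t \<subseteq> avoiders n 0"
  by (auto simp: avoiders_def)

text \<open>The maximum has a single position, so the sets for different \<open>s\<close> are
  disjoint, and deleting it turns the set for \<open>s\<close> into \<open>avoiders n s\<close>. Two
  choices of \<open>S\<close> occur: \<open>{Suc t..n}\<close> in the recurrence and
  \<open>{1..n}\<close> for words not starting with their maximum.\<close>

lemma card_avoiders_max_in:
  assumes "S \<subseteq> {..n}"
  shows "card {xs \<in> avoiders (Suc n) 0. \<exists>s\<in>S. xs ! s = Suc n} = (\<Sum>s\<in>S. card (avoiders n s))"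
proof -
  have "{xs \<in> avoiders (Suc n) 0. \<exists>s\<in>S. xs ! s = Suc n} =
        (\<Union>s\<in>S. {xs \<in> avoiders (Suc n) 0. xs ! s = Suc n})" by auto
  also have "card \<dots> = (\<Sum>s\<in>S. card {xs \<in> avoiders (Suc n) 0. xs ! s = Suc n})"
  proof (rule card_UN_disjoint)
    show "finite S" using assms finite_subset by blast
    show "\<forall>s\<in>S. \<forall>r\<in>S. s \<noteq> r \<longrightarrow> {xs \<in> avoiders (Suc n) 0. xs ! s = Suc n} \<inter>
            {xs \<in> avoiders (Suc n) 0. xs ! r = Suc n} = {}"
    proof (intro ballI impI)
      fix s r assume "s \<in> S" "r \<in> S" "s \<noteq> r"
      then have "s < Suc n" "r < Suc n" using assms by auto
      then have "xs ! s \<noteq> xs ! r" if "xs \<in> avoiders (Suc n) 0" for xs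
        using that \<open>s \<noteq> r\<close> avoiders_length[OF that] nth_eq_iff_index_eq[of xs s r]
        by (auto simp: avoiders_def)
      then show "{xs \<in> avoiders (Suc n) 0. xs ! s = Suc n} \<inter>
            {xs \<in> avoiders (Suc n) 0. xs ! r = Suc n} = {}" by force
    qed
  qed auto
  also have "\<dots> = (\<Sum>s\<in>S. card (avoiders n s))"
    using assms by (intro sum.cong) (auto simp: avoiders_max_at card_insert_at_avoiders)
  finally show ?thesis .
qed

section \<open>Recurrence in the length of the decreasing prefix\<close>

lemma take_insert_at:
  assumes "t \<le> s" "s \<le> length xs"
  shows "take t (insert_at s x xs) = take t xs"
  using assms by (simp add: insert_at_def min_def)

lemma sorted_wrt_take_mono:
  "t \<le> s \<Longrightarrow> sorted_wrt R (take s xs) \<Longrightarrow> sorted_wrt R (take t xs)"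
  by (metis min.absorb1 sorted_wrt_take take_take)

text \<open>If the first \<open>Suc t\<close> entries decrease, the maximum stands in front or
  behind all of them. In front, the next \<open>t\<close> entries must decrease; behind, at an index
  \<open>s > t\<close>, the condition already follows from the decreasing prefix of length
  \<open>s\<close>.\<close>

lemma avoiders_Suc:
  assumes "t \<le> n"
  shows "avoiders (Suc n) (Suc t) = insert_at 0 (Suc n) ` avoiders n t \<union>
           {xs \<in> avoiders (Suc n) 0. \<exists>s\<in>{Suc t..n}. xs ! s = Suc n}" (is "_ = ?A \<union> ?B")
proof -
  have zero: "insert_at 0 (Suc n) ys \<in> avoiders (Suc n) (Suc t) \<longleftrightarrow> ys \<in> avoiders n t"
    if "ys \<in> avoiders n 0" for ys
  proof -
    have "\<forall>y \<in> set ys. y \<le> Suc n" using that by (auto simp: avoiders_def)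
    then have "\<forall>y \<in> set (take t ys). y \<le> Suc n" by (meson in_set_takeD)
    moreover have "insert_at 0 (Suc n) ys \<in> avoiders (Suc n) 0"
      using that insert_at_mem_avoiders[of 0 n ys] avoiders_length by auto
    ultimately show ?thesis
      using that by (auto simp: avoiders_def insert_at_def)
  qed
  have "?A \<subseteq> avoiders (Suc n) (Suc t)"
    using zero avoiders_subset by blast
  moreover have "?B \<subseteq> avoiders (Suc n) (Suc t)"
  proof
    fix xs assume "xs \<in> ?B"
    then obtain s where s: "xs \<in> avoiders (Suc n) 0" "Suc t \<le> s" "s \<le> n" "xs ! s = Suc n" by auto
    then obtain ys where ys: "ys \<in> avoiders n s" "xs = insert_at s (Suc n) ys"
      using avoiders_max_at[of s n] by blast
    then have "sorted_wrt (\<ge>) (take (Suc t) ys)"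
      using sorted_wrt_take_mono[OF s(2)] by (auto simp: avoiders_def)
    then have "sorted_wrt (\<ge>) (take (Suc t) xs)"
      using ys s take_insert_at[of "Suc t" s ys] avoiders_length by auto
    then show "xs \<in> avoiders (Suc n) (Suc t)" using s(1) by (auto simp: avoiders_def)
  qed
  moreover have "avoiders (Suc n) (Suc t) \<subseteq> ?A \<union> ?B"
  proof
    fix xs assume xs: "xs \<in> avoiders (Suc n) (Suc t)"
    have xs0: "xs \<in> avoiders (Suc n) 0" using xs avoiders_subset by blast
    from xs obtain s where s: "s \<le> n" "xs ! s = Suc n" by (rule avoiders_max_pos)
    have len: "length xs = Suc n" using xs avoiders_length by blast
    consider "s = 0" | "0 < s" "s < Suc t" | "Suc t \<le> s" by linarith
    then show "xs \<in> ?A \<union> ?B"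
    proof cases
      case 1
      then have "xs \<in> insert_at 0 (Suc n) ` avoiders n 0"
        using avoiders_max_at[of 0 n] s xs0 by auto
      then show ?thesis using zero xs by blast
    next
      case 2
      have "sorted_wrt (\<ge>) (take (Suc t) xs)" using xs by (auto simp: avoiders_def)
      then have "xs ! 0 \<ge> xs ! s"
        using 2 len assms sorted_wrt_nth_less[of "(\<ge>)" "take (Suc t) xs" 0 s] by simp
      moreover have "xs ! 0 \<in> {1..Suc n}"
        using xs0 len nth_mem[of 0 xs] by (auto simp: avoiders_def)
      ultimately have "xs ! 0 = xs ! s" using s by auto
      then have False
        using xs0 2 len s nth_eq_iff_index_eq[of xs 0 s] by (auto simp: avoiders_def)
      then show ?thesis ..
    next
      case 3
      then show ?thesis using s xs0 by auto
    qed
  qed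
  ultimately show ?thesis by blast
qed

lemma card_avoiders_Suc:
  assumes "t \<le> n"
  shows "card (avoiders (Suc n) (Suc t)) = (\<Sum>s=t..n. card (avoiders n s))"
proof -
  let ?A = "insert_at 0 (Suc n) ` avoiders n t"
  let ?B = "{xs \<in> avoiders (Suc n) 0. \<exists>s\<in>{Suc t..n}. xs ! s = Suc n}"
  have "?A \<inter> ?B = {}"
  proof -
    have "False" if "xs \<in> ?A" "xs \<in> ?B" for xs
    proof -
      from that(2) obtain s where s: "xs \<in> avoiders (Suc n) 0" "Suc t \<le> s" "s \<le> n" "xs ! s = Suc n"
        by auto
      moreover have "xs ! 0 = Suc n" using that(1) by (auto simp: insert_at_def)
      ultimately show False
        using nth_eq_iff_index_eq[of xs 0 s] avoiders_length[OF s(1)] by (auto simp: avoiders_def)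
    qed
    then show ?thesis by blast
  qed
  then have "card (avoiders (Suc n) (Suc t)) = card ?A + card ?B"
    unfolding avoiders_Suc[OF assms] by (intro card_Un_disjoint) auto
  also have "\<dots> = card (avoiders n t) + (\<Sum>s\<in>{Suc t..n}. card (avoiders n s))"
    by (subst card_avoiders_max_in) (auto simp: card_insert_at_avoiders)
  \<comment> \<open>The front insertion supplies the summand \<open>s = t\<close>.\<close>
  also have "\<dots> = (\<Sum>s=t..n. card (avoiders n s))"
    using assms by (simp add: sum.atLeast_Suc_atMost)
  finally show ?thesis .
qed

section \<open>Ballot numbers\<close>

lemma avoiders_0_eq_1: "avoiders n 0 = avoiders n 1"
proof -
  have "sorted_wrt (\<ge>) (take 1 xs)" for xs :: "nat list"
    by (cases xs) auto
  then show ?thesis by (auto simp: avoiders_def)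
qed

text \<open>By Pascal's rule, the summand at \<open>s\<close> is the right-hand side at
  \<open>s\<close> minus the one at \<open>Suc s\<close>. The hypothesis admits
  \<open>t = Suc n\<close>, where both sides vanish, as the start of the downward induction.\<close>

lemma sum_ballot_telescope:
  assumes "t \<le> Suc n"
  shows "(\<Sum>s=t..n. int (2 * n - s choose n) - int (2 * n - s choose Suc n)) =
         int (2 * n + 1 - t choose Suc n) - int (2 * n + 1 - t choose Suc (Suc n))"
  using assms
proof (induction rule: inc_induct)
  case base
  then show ?case by (simp add: binomial_eq_0)
next
  case (step t)
  then have "2 * n + 1 - t = Suc (2 * n - t)" by simp
  then show ?case using step by (simp add: sum.atLeast_Suc_atMost)
qed

text \<open>The recurrence \<open>card_avoiders_Suc\<close> turns the formula for \<open>n\<close>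
  into the telescoping sum. The values are ballot numbers, and Catalan numbers for
  \<open>t = 0\<close>.\<close>

lemma card_avoiders:
  "t \<le> n \<Longrightarrow> int (card (avoiders n t)) = int (2 * n - t choose n) - int (2 * n - t choose Suc n)"
proof (induction n arbitrary: t)
  case 0
  have "avoiders 0 0 = {[]}" by (auto simp: avoiders_def)
  then show ?case using 0 by simp
next
  case (Suc n)
  have pos: "int (card (avoiders (Suc n) (Suc r))) =
      int (2 * n + 1 - r choose Suc n) - int (2 * n + 1 - r choose Suc (Suc n))"
    if "r \<le> n" for r
    using that sum_ballot_telescope[of r n] by (simp add: card_avoiders_Suc Suc.IH)
  show ?case
  proof (cases t)
    case 0
    \<comment> \<open>The recurrence only reaches positive prefix lengths. For \<open>t = 0\<close>,
      \<open>avoiders_0_eq_1\<close> passes to \<open>t = 1\<close>, and the two formulas agree by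
      Pascal's rule and this symmetry.\<close>
    have "(2 * n + 1 choose n) = (2 * n + 1 choose Suc n)"
      using binomial_symmetric[of n "2 * n + 1"] by simp
    then show ?thesis using pos[of 0] 0 by (simp add: avoiders_0_eq_1)
  next
    case (Suc r)
    then show ?thesis using pos[of r] Suc.prems by simp
  qed
qed

text \<open>The maximum sits at an index from 1 to \<open>n\<close>, so the ballot sum telescopes
  from \<open>t = 1\<close>.\<close>

lemma card_avoiders_hd_not_max:
  "int (card {xs \<in> avoiders (Suc n) 0. xs ! 0 \<noteq> Suc n}) =
   int (2 * n choose Suc n) - int (2 * n choose Suc (Suc n))"
proof -
  have "{xs \<in> avoiders (Suc n) 0. xs ! 0 \<noteq> Suc n} =
        {xs \<in> avoiders (Suc n) 0. \<exists>s\<in>{1..n}. xs ! s = Suc n}"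
  proof -
    have "xs ! 0 \<noteq> Suc n \<longleftrightarrow> (\<exists>s\<in>{1..n}. xs ! s = Suc n)" if xs: "xs \<in> avoiders (Suc n) 0" for xs
    proof -
      obtain s where s: "s \<le> n" "xs ! s = Suc n" using xs by (rule avoiders_max_pos)
      have "r = s" if "r \<le> n" "xs ! r = Suc n" for r
        using that s nth_eq_iff_index_eq[of xs r s] avoiders_length[OF xs] xs
        by (auto simp: avoiders_def)
      then show ?thesis using s by (metis One_nat_def Suc_leI atLeastAtMost_iff le0 not_gr_zero not_one_le_zero)
    qed
    then show ?thesis by blast
  qed
  then have "int (card {xs \<in> avoiders (Suc n) 0. xs ! 0 \<noteq> Suc n}) =
      (\<Sum>s=1..n. int (2 * n - s choose n) - int (2 * n - s choose Suc n))"
    by (simp add: card_avoiders_max_in card_avoiders)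
  also have "\<dots> = int (2 * n choose Suc n) - int (2 * n choose Suc (Suc n))"
    using sum_ballot_telescope[of 1 n] by simp
  finally show ?thesis .
qed

subsection \<open>Involutions with one increasing triple\<close>

text \<open>Ordered triples replace the index sets of \<open>occurrences\<close>, so that uniqueness
  can be used componentwise and \<open>p\<close> can be applied entry by entry.\<close>

definition triples_123 :: "nat \<Rightarrow> (nat \<Rightarrow> nat) \<Rightarrow> (nat \<times> nat \<times> nat) set" where
  "triples_123 n p = {(a, b, c). 1 \<le> a \<and> a < b \<and> b < c \<and> c \<le> n \<and> p a < p b \<and> p b < p c}"

lemma sorted_list_of_set_triple:
  fixes a b c :: "'a::linorder"
  assumes "a < b" "b < c"
  shows "sorted_list_of_set {a, b, c} = [a, b, c]"
proof -
  have "sorted [a, b, c]" "distinct [a, b, c]" using assms by auto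
  then have "sorted_list_of_set (set [a, b, c]) = [a, b, c]"
    by (rule sorted_list_of_set.idem_if_sorted_distinct)
  then show ?thesis by (simp only: list.set)
qed

lemma order_isomorphic_123: "order_isomorphic [x, y, z] [1, 2, 3] \<longleftrightarrow> x < y \<and> y < z"
  by (auto simp: order_isomorphic_def less_Suc_eq numeral_3_eq_3)

lemma occurrences_123: "occurrences n p [1, 2, 3] = (\<lambda>(a, b, c). {a, b, c}) ` triples_123 n p"
proof (intro equalityI subsetI)
  fix I assume "I \<in> occurrences n p [1, 2, 3]"
  then have sub: "I \<subseteq> {1..n}" and iso: "order_isomorphic (map p (sorted_list_of_set I)) [1, 2, 3]"
    by (auto simp: occurrences_def)
  then have fin: "finite I" using finite_subset by blast
  have "length (sorted_list_of_set I) = 3" using iso by (simp add: order_isomorphic_def)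
  then obtain a b c where abc: "sorted_list_of_set I = [a, b, c]"
    by (auto simp only: numeral_3_eq_3 length_Suc_conv length_0_conv)
  then have I: "I = {a, b, c}" using set_sorted_list_of_set[OF fin] by auto
  have "a < b" "b < c" using strict_sorted_list_of_set[of I] abc by auto
  then have "(a, b, c) \<in> triples_123 n p"
    using iso abc I sub order_isomorphic_123 by (auto simp: triples_123_def)
  then show "I \<in> (\<lambda>(a, b, c). {a, b, c}) ` triples_123 n p" using I by force
next
  fix I assume "I \<in> (\<lambda>(a, b, c). {a, b, c}) ` triples_123 n p"
  then show "I \<in> occurrences n p [1, 2, 3]"
    using order_isomorphic_123
    by (auto simp: occurrences_def triples_123_def sorted_list_of_set_triple)
qed

lemma ex1_mem_iff_card: "(\<exists>!x. x \<in> A) \<longleftrightarrow> card A = 1"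
  unfolding One_nat_def card_1_singleton_iff by auto

lemma contains_once_123_iff: "contains_once n p [1, 2, 3] \<longleftrightarrow> (\<exists>!t. t \<in> triples_123 n p)"
proof -
  have "inj_on (\<lambda>(a, b, c). {a, b, c}) (triples_123 n p)"
  proof (rule inj_onI)
    fix s t assume "s \<in> triples_123 n p" "t \<in> triples_123 n p"
      and "(case s of (a, b, c) \<Rightarrow> {a, b, c}) = (case t of (a, b, c) \<Rightarrow> {a, b, c})"
    then obtain a b c a' b' c' where *: "s = (a, b, c)" "t = (a', b', c')"
      "a < b" "b < c" "a' < b'" "b' < c'" "{a, b, c} = {a', b', c'}"
      by (auto simp: triples_123_def)
    then have "[a, b, c] = [a', b', c']"
      by (metis sorted_list_of_set_triple)
    then show "s = t" using * by simp
  qed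
  then show ?thesis
    unfolding contains_once_def occurrences_123 ex1_mem_iff_card by (simp add: card_image)
qed

section \<open>Shape of an involution with a single 123\<close>

lemma involutionsD:
  assumes "p \<in> involutions n"
  shows "p permutes {1..n}" and "p (p x) = x"
proof -
  show *: "p permutes {1..n}" using assms by (simp add: involutions_def)
  have "p (inv p x) = x" using * by (simp add: permutes_inverses)
  then show "p (p x) = x" using assms by (simp add: involutions_def)
qed

lemma involutionsI:
  assumes "\<And>x. p (p x) = x" and "\<And>x. x \<notin> {1..n} \<Longrightarrow> p x = x"
  shows "p \<in> involutions n"
proof -
  have "p permutes {1..n}" unfolding permutes_def using assms by metis
  moreover have "inv p = p" using assms(1) by (intro inv_unique_comp) auto
  ultimately show ?thesis by (simp add: involutions_def)
qed

text \<open>This is only the necessary shape: centre \<open>m\<close>, three fixed points, all other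
  points exchanged between the two halves. Uniqueness of the 123 is left to
  \<open>crossing_once_iff\<close>, which turns it into avoidance by a word.\<close>

definition crossing :: "nat \<Rightarrow> (nat \<Rightarrow> nat) \<Rightarrow> nat \<Rightarrow> nat \<Rightarrow> bool" where
  "crossing m p i k \<longleftrightarrow> p \<in> involutions (2 * m - 1) \<and> 1 \<le> i \<and> i < m \<and> m < k \<and> k < 2 * m \<and>
     p i = i \<and> p m = m \<and> p k = k \<and>
     (\<forall>x. 1 \<le> x \<and> x < m \<and> x \<noteq> i \<longrightarrow> m < p x) \<and>
     (\<forall>x. m < x \<and> x < 2 * m \<and> x \<noteq> k \<longrightarrow> p x < m)"

lemma crossingD:
  assumes "crossing m p i k"
  shows "p (p x) = x" and "x \<in> {1..<2 * m} \<Longrightarrow> p x \<in> {1..<2 * m}"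
    and "x \<notin> {1..<2 * m} \<Longrightarrow> p x = x"
proof -
  have p: "p \<in> involutions (2 * m - 1)" and eq: "{1..2 * m - 1} = {1..<2 * m}"
    using assms by (auto simp: crossing_def)
  show "p (p x) = x" by (rule involutionsD(2)[OF p])
  show "x \<in> {1..<2 * m} \<Longrightarrow> p x \<in> {1..<2 * m}"
    using permutes_in_image[OF involutionsD(1)[OF p], of x] unfolding eq by blast
  show "x \<notin> {1..<2 * m} \<Longrightarrow> p x = x"
    using permutes_not_in[OF involutionsD(1)[OF p], of x] unfolding eq by blast
qed

text \<open>Every other point is moved across \<open>m\<close>. Hence \<open>i\<close> and
  \<open>k\<close> can be read off from \<open>p\<close> as its least and greatest fixed
  points.\<close>

lemma crossing_fixed_points:
  assumes "crossing m p i k"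
  shows "fixed_points (2 * m - 1) p = {i, m, k}"
proof
  show "{i, m, k} \<subseteq> fixed_points (2 * m - 1) p"
    using assms by (auto simp: crossing_def fixed_points_def)
  show "fixed_points (2 * m - 1) p \<subseteq> {i, m, k}"
  proof
    fix x assume x: "x \<in> fixed_points (2 * m - 1) p"
    have "x < m \<or> x = m \<or> m < x" by linarith
    then show "x \<in> {i, m, k}" using assms x unfolding crossing_def fixed_points_def by force
  qed
qed

lemma involution_once_crossing:
  assumes p: "p \<in> involutions n" and once: "contains_once n p [1, 2, 3]"
  obtains m i k where "n = 2 * m - 1" and "crossing m p i k"
proof -
  obtain i m k where t: "(i, m, k) \<in> triples_123 n p"
    and uniq: "\<And>a b c. (a, b, c) \<in> triples_123 n p \<Longrightarrow> a = i \<and> b = m \<and> c = k"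
    using once unfolding contains_once_123_iff by (metis prod.inject prod_cases3)
  have pp: "p (p x) = x" for x by (rule involutionsD(2)[OF p])
  have range: "p x \<in> {1..n} \<longleftrightarrow> x \<in> {1..n}" for x
    by (rule permutes_in_image[OF involutionsD(1)[OF p]])
  have ord: "1 \<le> i" "i < m" "m < k" "k \<le> n" using t by (auto simp: triples_123_def)
  have "(p i, p m, p k) \<in> triples_123 n p"
    using t range[of i] range[of k] pp by (auto simp: triples_123_def)
  then have fixed: "p i = i" "p m = m" "p k = k" using uniq by blast+
  \<comment> \<open>A value below \<open>m\<close> here would make \<open>(x, m, k)\<close> a second
    occurrence; on the right, \<open>(i, m, x)\<close> plays that role.\<close>
  have left: "m < p x" if "1 \<le> x" "x < m" "x \<noteq> i" for x
  proof (rule ccontr)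
    assume "\<not> m < p x"
    moreover have "p x \<noteq> m" using pp[of x] fixed that by auto
    ultimately have "(x, m, k) \<in> triples_123 n p"
      using that ord fixed by (auto simp: triples_123_def)
    then show False using uniq that by blast
  qed
  have right: "p x < m" if "m < x" "x \<le> n" "x \<noteq> k" for x
  proof (rule ccontr)
    assume "\<not> p x < m"
    moreover have "p x \<noteq> m" using pp[of x] fixed that by auto
    ultimately have "(i, m, x) \<in> triples_123 n p"
      using that ord fixed by (auto simp: triples_123_def)
    then show False using uniq that by blast
  qed
  \<comment> \<open>Comparing sizes, \<open>m - 2\<close> on the left and \<open>n - m - 1\<close>
    on the right, puts \<open>m\<close> in the centre.\<close>
  have "bij_betw p ({1..<m} - {i}) ({m<..n} - {k})"
  proof (rule bij_betw_byWitness[where f' = p])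
    show "p ` ({1..<m} - {i}) \<subseteq> {m<..n} - {k}"
    proof
      fix y assume "y \<in> p ` ({1..<m} - {i})"
      then obtain x where "y = p x" and "x \<in> {1..<m} - {i}" by blast
      then have x: "y = p x" "1 \<le> x" "x < m" "x \<noteq> i" by auto
      then have "y \<le> n" "p y = x" using range[of x] ord pp by auto
      then show "y \<in> {m<..n} - {k}" using left[of x] x ord fixed by auto
    qed
    show "p ` ({m<..n} - {k}) \<subseteq> {1..<m} - {i}"
    proof
      fix y assume "y \<in> p ` ({m<..n} - {k})"
      then obtain x where "y = p x" and "x \<in> {m<..n} - {k}" by blast
      then have x: "y = p x" "m < x" "x \<le> n" "x \<noteq> k" by auto
      then have "1 \<le> y" "p y = x" using range[of x] ord pp by auto
      then show "y \<in> {1..<m} - {i}" using right[of x] x ord fixed by auto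
    qed
  qed (auto simp: pp)
  then have "card ({1..<m} - {i}) = card ({m<..n} - {k})" by (rule bij_betw_same_card)
  then have n: "n = 2 * m - 1" using ord by simp
  moreover have "crossing m p i k"
    unfolding crossing_def using p n ord fixed left right by auto
  ultimately show ?thesis using that by blast
qed

text \<open>For a crossing \<open>p\<close>, the values on \<open>{m..<2 * m}\<close> are
  \<open>m\<close>, \<open>k\<close> and everything from 1 to \<open>m - 1\<close> except
  \<open>i\<close>. The replacement supplies the missing \<open>i\<close> and removes the too large
  \<open>k\<close>.\<close>

definition fold_fun :: "nat \<Rightarrow> (nat \<Rightarrow> nat) \<Rightarrow> nat \<Rightarrow> nat \<Rightarrow> nat \<Rightarrow> nat" where
  "fold_fun m p i k x = (if x = m then i else if x = k then m else p x)"

text \<open>Rising triples of the folded word match rising triples of \<open>p\<close> whose middle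
  position lies right of \<open>m\<close>, where the letter \<open>i\<close> moves between position
  \<open>m\<close> in the word and position \<open>i\<close> in \<open>p\<close>. Avoidance excludes
  these and, after applying \<open>p\<close>, also those with middle value above \<open>m\<close>;
  only \<open>(i, m, k)\<close> survives.\<close>

lemma crossing_once_iff:
  assumes cr: "crossing m p i k"
  shows "contains_once (2 * m - 1) p [1, 2, 3] \<longleftrightarrow>
         avoids_123 (map (fold_fun m p i k) [m..<2 * m])" (is "_ \<longleftrightarrow> ?A")
proof -
  define T where "T = triples_123 (2 * m - 1) p"
  have ord: "1 \<le> i" "i < m" "m < k" "k < 2 * m" and fixed: "p i = i" "p m = m" "p k = k"
    and left: "\<And>x. 1 \<le> x \<Longrightarrow> x < m \<Longrightarrow> x \<noteq> i \<Longrightarrow> m < p x"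
    and right: "\<And>x. m < x \<Longrightarrow> x < 2 * m \<Longrightarrow> x \<noteq> k \<Longrightarrow> p x < m"
    using cr by (auto simp: crossing_def)
  have pp: "p (p x) = x" for x by (rule crossingD(1)[OF cr])
  have range: "x \<in> {1..<2 * m} \<Longrightarrow> p x \<in> {1..<2 * m}" for x by (rule crossingD(2)[OF cr])
  have T_iff: "(a, b, c) \<in> T \<longleftrightarrow> 1 \<le> a \<and> a < b \<and> b < c \<and> c < 2 * m \<and> p a < p b \<and> p b < p c" for a b c
    using ord by (auto simp: T_def triples_123_def)
  have "(i, m, k) \<in> T" using ord fixed by (simp add: T_iff)
  then have "contains_once (2 * m - 1) p [1, 2, 3] \<longleftrightarrow> (\<forall>t. t \<in> T \<longrightarrow> t = (i, m, k))"
    unfolding contains_once_123_iff T_def[symmetric] by blast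
  then have once: "contains_once (2 * m - 1) p [1, 2, 3] \<longleftrightarrow>
      (\<forall>a b c. (a, b, c) \<in> T \<longrightarrow> a = i \<and> b = m \<and> c = k)"
    by simp
  have A: "?A \<longleftrightarrow> (\<forall>a b c. m \<le> a \<and> a < b \<and> b < c \<and> c < 2 * m \<longrightarrow>
      \<not> (fold_fun m p i k a < fold_fun m p i k b \<and> fold_fun m p i k b < fold_fun m p i k c))"
    by (rule avoids_123_map_upt)
  show ?thesis
  proof
    assume "contains_once (2 * m - 1) p [1, 2, 3]"
    note uniq = this[unfolded once, rule_format]
    show ?A
      unfolding A
    proof (intro allI impI notI)
      fix a b c
      assume abc: "m \<le> a \<and> a < b \<and> b < c \<and> c < 2 * m"
        and inc: "fold_fun m p i k a < fold_fun m p i k b \<and> fold_fun m p i k b < fold_fun m p i k c"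
      \<comment> \<open>\<open>m\<close> is the largest letter of the word, so its position
        \<open>k\<close> can only be the last of the three.\<close>
      have bk: "b \<noteq> k"
        using inc abc right[of c] by (auto simp: fold_fun_def split: if_splits)
      \<comment> \<open>The word has the letter \<open>i\<close> at position \<open>m\<close>,
        whereas \<open>p\<close> has it at position \<open>i\<close>.\<close>
      define a' where "a' = (if a = m then i else a)"
      have ak: "a \<noteq> k" using inc abc ord right[of b] bk by (auto simp: fold_fun_def split: if_splits)
      have "p b < p c"
        using inc abc bk ord fixed right[of b] by (auto simp: fold_fun_def split: if_splits)
      moreover have "p a' < p b"
        using inc abc bk ak fixed by (auto simp: fold_fun_def a'_def split: if_splits)
      ultimately have "(a', b, c) \<in> T"
        using abc ord by (auto simp: T_iff a'_def)
      then have "b = m" using uniq by blast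
      then show False using abc by simp
    qed
  next
    assume ?A
    note av = this[unfolded A, rule_format]
    have not_right: "b \<le> m" if "(a, b, c) \<in> T" for a b c
    proof (rule ccontr)
      assume "\<not> b \<le> m"
      with that have abc: "1 \<le> a" "a < b" "m < b" "b < c" "c < 2 * m" "p a < p b" "p b < p c"
        by (auto simp: T_iff)
      have bk: "b \<noteq> k" using abc right[of c] fixed by auto
      then have pb: "p b < m" using right[of b] abc by auto
      have am: "a \<noteq> m" using abc pb fixed by auto
      have ak: "a \<noteq> k" using abc pb fixed ord by auto
      have ai: "a = i \<or> m < a" using left[of a] abc pb am by force
      define a' where "a' = (if a = i then m else a)"
      have "fold_fun m p i k a' < fold_fun m p i k b"
        using abc bk am ak ord fixed by (auto simp: fold_fun_def a'_def)
      moreover have "fold_fun m p i k b < fold_fun m p i k c"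
        using abc bk pb by (auto simp: fold_fun_def)
      moreover have "m \<le> a' \<and> a' < b \<and> b < c \<and> c < 2 * m"
        using abc ai by (auto simp: a'_def)
      ultimately show False using av by blast
    qed
    show "contains_once (2 * m - 1) p [1, 2, 3]"
      unfolding once
    proof (intro allI impI)
      fix a b c assume t: "(a, b, c) \<in> T"
      then have abc: "1 \<le> a" "a < b" "b < c" "c < 2 * m" "p a < p b" "p b < p c"
        by (auto simp: T_iff)
      \<comment> \<open>This is again a rising triple, now with middle position \<open>p b\<close>,
        so \<open>not_right\<close> bounds position and value of the middle entry alike. Among the
        positions from 1 to \<open>m\<close>, only \<open>i\<close> and \<open>m\<close> have a
        value of at most \<open>m\<close>.\<close>
      have "(p a, p b, p c) \<in> T"
        using abc range[of a] range[of c] pp by (auto simp: T_iff)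
      then have "p b \<le> m" "b \<le> m" using not_right t by blast+
      moreover have "b \<noteq> i" using abc left[of a] fixed ord by force
      ultimately have "b = m" using left[of b] abc by force
      moreover have "a = i" using abc left[of a] fixed \<open>b = m\<close> by force
      moreover have "c = k" using abc right[of c] fixed \<open>b = m\<close> by force
      ultimately show "a = i \<and> b = m \<and> c = k" by blast
    qed
  qed
qed

subsection \<open>Folding an involution into a 123-avoiding word\<close>

text \<open>Taking \<open>i\<close> and \<open>k\<close> from the fixed points makes the word a
  function of \<open>m\<close> and \<open>p\<close> alone, as the bijection requires.\<close>

definition fold_word :: "nat \<Rightarrow> (nat \<Rightarrow> nat) \<Rightarrow> nat list" where
  "fold_word m p = map (fold_fun m p (Min (fixed_points (2 * m - 1) p))
                                     (Max (fixed_points (2 * m - 1) p))) [m..<2 * m]"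

lemma fold_word_crossing:
  assumes "crossing m p i k"
  shows "fold_word m p = map (fold_fun m p i k) [m..<2 * m]"
proof -
  have "i < m" "m < k" using assms by (auto simp: crossing_def)
  then have "Min {i, m, k} = i" "Max {i, m, k} = k" by simp_all
  then show ?thesis unfolding fold_word_def crossing_fixed_points[OF assms] by simp
qed

lemma fold_word_mem:
  assumes cr: "crossing m p i k" and "avoids_123 (fold_word m p)"
  shows "fold_word m p \<in> avoiders m 0" and "fold_word m p ! 0 \<noteq> m"
proof -
  let ?f = "fold_fun m p i k"
  note w = fold_word_crossing[OF cr]
  have ord: "1 \<le> i" "i < m" "m < k" "k < 2 * m" and fixed: "p i = i" "p m = m" "p k = k"
    and right: "\<And>x. m < x \<Longrightarrow> x < 2 * m \<Longrightarrow> x \<noteq> k \<Longrightarrow> p x < m"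
    using cr by (auto simp: crossing_def)
  have pp: "p (p x) = x" for x by (rule crossingD(1)[OF cr])
  have range: "x \<in> {1..<2 * m} \<Longrightarrow> p x \<in> {1..<2 * m}" for x by (rule crossingD(2)[OF cr])
  have inj: "inj_on ?f {m..<2 * m}"
  proof (rule inj_onI)
    fix x y assume xy: "x \<in> {m..<2 * m}" "y \<in> {m..<2 * m}" "?f x = ?f y"
    have p_inj: "p a = p b \<longleftrightarrow> a = b" for a b using pp by metis
    \<comment> \<open>As \<open>p\<close> is injective and fixes \<open>i\<close> and
      \<open>m\<close>, no position right of \<open>m\<close> takes these values, so the substituted
      letters cause no collision.\<close>
    have "p a \<noteq> i" "p a \<noteq> m" if "a \<in> {m..<2 * m}" "a \<noteq> m" for a
      using p_inj[of a i] p_inj[of a m] fixed that ord by auto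
    then have "x \<noteq> m \<Longrightarrow> p x \<noteq> i \<and> p x \<noteq> m" "y \<noteq> m \<Longrightarrow> p y \<noteq> i \<and> p y \<noteq> m"
      using xy by blast+
    then show "x = y"
      using xy(3) p_inj[of x y] ord by (auto simp: fold_fun_def split: if_splits)
  qed
  have "?f x \<in> {1..m}" if "x \<in> {m..<2 * m}" for x
    using that ord right[of x] range[of x] by (auto simp: fold_fun_def)
  then have "?f ` {m..<2 * m} \<subseteq> {1..m}" by blast
  then have "?f ` {m..<2 * m} = {1..m}"
    using card_image[OF inj] by (intro card_subset_eq) auto
  then show "fold_word m p \<in> avoiders m 0"
    using assms(2) inj by (simp add: avoiders_def w distinct_map)
  show "fold_word m p ! 0 \<noteq> m"
    using ord by (simp add: w fold_fun_def)
qed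

text \<open>The word reveals \<open>i\<close> as its first letter, \<open>k\<close> by the position
  of its largest letter, and the other values right of \<open>m\<close>; those left of
  \<open>m\<close> follow from involutivity.\<close>

lemma fold_word_inj:
  assumes p: "crossing m p i k" and q: "crossing m q i' k'" and eq: "fold_word m p = fold_word m q"
  shows "p = q"
proof -
  have f: "fold_fun m p i k x = fold_fun m q i' k' x" if "m \<le> x" "x < 2 * m" for x
    using eq that unfolding fold_word_crossing[OF p] fold_word_crossing[OF q] by simp
  have ordp: "1 \<le> i" "i < m" "m < k" "k < 2 * m" and fixp: "p i = i" "p m = m" "p k = k"
    and rp: "\<And>x. m < x \<Longrightarrow> x < 2 * m \<Longrightarrow> x \<noteq> k \<Longrightarrow> p x < m"
    and lp: "\<And>x. 1 \<le> x \<Longrightarrow> x < m \<Longrightarrow> x \<noteq> i \<Longrightarrow> m < p x"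
    using p by (auto simp: crossing_def)
  have ordq: "1 \<le> i'" "i' < m" "m < k'" "k' < 2 * m" and fixq: "q i' = i'" "q m = m" "q k' = k'"
    and rq: "\<And>x. m < x \<Longrightarrow> x < 2 * m \<Longrightarrow> x \<noteq> k' \<Longrightarrow> q x < m"
    using q by (auto simp: crossing_def)
  have i: "i' = i" using f[of m] ordp by (simp add: fold_fun_def)
  have k: "k' = k" using f[of k] ordp ordq rq[of k] by (auto simp: fold_fun_def split: if_splits)
  have right: "p x = q x" if "m < x" "x < 2 * m" "x \<noteq> k" for x
    using f[of x] that k by (simp add: fold_fun_def)
  show "p = q"
  proof
    fix x
    consider "x \<notin> {1..<2 * m}" | "x \<in> {i, m, k}" | "m < x" "x < 2 * m" "x \<noteq> k"
      | "1 \<le> x" "x < m" "x \<noteq> i"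
      by (auto simp: not_le not_less) linarith
    then show "p x = q x"
    proof cases
      case 1
      then show ?thesis using crossingD(3)[OF p] crossingD(3)[OF q] by simp
    next
      case 2
      then show ?thesis using fixp fixq i k by auto
    next
      case 3
      then show ?thesis by (rule right)
    next
      case 4
      then have "m < p x" "p x < 2 * m" using lp crossingD(2)[OF p, of x] by auto
      moreover have "p x \<noteq> k" using crossingD(1)[OF p, of x] fixp 4 ordp by auto
      ultimately have "p (p x) = q (p x)" by (intro right)
      then show ?thesis by (metis crossingD(1)[OF p] crossingD(1)[OF q])
    qed
  qed
qed

text \<open>The involution reads the word on the right half and its inverse on the left half, with
  fixed points at the first letter, the centre and the position of the largest letter.\<close>

lemma fold_word_surj:
  assumes xs: "xs \<in> avoiders m 0" and hd: "xs ! 0 \<noteq> m" and "1 \<le> m"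
  obtains p i k where "crossing m p i k" and "fold_word m p = xs"
proof -
  have len: "length xs = m" using xs by (rule avoiders_length)
  define q where "q x = xs ! (x - m)" for x
  have "map q [m..<2 * m] = xs"
    by (rule nth_equalityI) (auto simp: len q_def)
  then have "distinct (map q [m..<2 * m])" and "set (map q [m..<2 * m]) = {1..m}"
    using xs by (auto simp: avoiders_def)
  then have bij: "bij_betw q {m..<2 * m} {1..m}"
    by (simp add: bij_betw_def distinct_map)
  define r where "r = inv_into {m..<2 * m} q"
  have qr: "q (r y) = y" and rD: "m \<le> r y" "r y < 2 * m" if "1 \<le> y" "y \<le> m" for y
    using bij_betw_inv_into_right[OF bij, of y] bij_betwE[OF bij_betw_inv_into[OF bij], rule_format, of y] that
    by (auto simp: r_def)
  have rq: "r (q x) = x" and qD: "1 \<le> q x" "q x \<le> m" if "m \<le> x" "x < 2 * m" for x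
    using bij_betw_inv_into_left[OF bij, of x] bij_betwE[OF bij, rule_format, of x] that
    by (auto simp: r_def)
  define i where "i = q m"
  define k where "k = r m"
  \<comment> \<open>The condition on the first letter enters here: it puts \<open>i\<close> below
    \<open>m\<close> and thereby keeps \<open>k\<close> away from \<open>m\<close>.\<close>
  have i: "1 \<le> i" "i < m" using qD[of m] hd \<open>1 \<le> m\<close> by (auto simp: i_def q_def)
  have k: "q k = m" "k < 2 * m" using qr[of m] rD[of m] \<open>1 \<le> m\<close> by (auto simp: k_def)
  have "m \<le> k" "k \<noteq> m" using rD(1)[of m] \<open>1 \<le> m\<close> k(1) i by (auto simp: k_def i_def)
  then have mk: "m < k" by simp
  define p where "p x = (if x \<notin> {1..<2 * m} \<or> x \<in> {i, m, k} then x else if m < x then q x else r x)" for x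
  have right: "p x = q x \<and> 1 \<le> q x \<and> q x < m \<and> q x \<noteq> i" if "m < x" "x < 2 * m" "x \<noteq> k" for x
  proof -
    have "q x \<noteq> m" using rq[of x] that by (auto simp: k_def)
    moreover have "q x \<noteq> i" using rq[of x] rq[of m] that by (auto simp: i_def)
    ultimately show ?thesis using that qD[of x] i by (auto simp: p_def)
  qed
  have left: "p x = r x \<and> m < r x \<and> r x < 2 * m \<and> r x \<noteq> k" if "1 \<le> x" "x < m" "x \<noteq> i" for x
  proof -
    have "r x \<noteq> m" using qr[of x] that by (auto simp: i_def)
    moreover have "r x \<noteq> k" using qr[of x] k that by auto
    ultimately show ?thesis using that rD[of x] mk by (auto simp: p_def)
  qed
  have pp: "p (p x) = x" for x
  proof -
    consider "x \<notin> {1..<2 * m} \<or> x \<in> {i, m, k}" | "m < x" "x < 2 * m" "x \<noteq> k"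
      | "1 \<le> x" "x < m" "x \<noteq> i"
      by (auto simp: not_le not_less) linarith
    then show ?thesis
    proof cases
      case 1
      then have "p x = x" by (simp add: p_def)
      then show ?thesis by simp
    next
      case 2
      then show ?thesis using right[of x] left[of "q x"] rq[of x] by simp
    next
      case 3
      then show ?thesis using left[of x] right[of "r x"] qr[of x] by simp
    qed
  qed
  have "p \<in> involutions (2 * m - 1)"
    using pp by (intro involutionsI) (auto simp: p_def)
  then have cr: "crossing m p i k"
    using i mk k(2) left right by (auto simp: crossing_def p_def[of i] p_def[of m] p_def[of k])
  have "fold_fun m p i k x = q x" if "m \<le> x" "x < 2 * m" for x
    using that right[of x] k(1) by (auto simp: fold_fun_def i_def)
  then have "map (fold_fun m p i k) [m..<2 * m] = map q [m..<2 * m]" by auto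
  then have "fold_word m p = xs"
    using \<open>map q [m..<2 * m] = xs\<close> fold_word_crossing[OF cr] by simp
  with cr show ?thesis by (rule that)
qed

section \<open>The bijection and the closed form\<close>

lemma card_involutions_once_123:
  assumes "1 \<le> m"
  shows "card {p \<in> involutions (2 * m - 1). contains_once (2 * m - 1) p [1, 2, 3]} =
         card {xs \<in> avoiders m 0. xs ! 0 \<noteq> m}" (is "card ?P = card ?W")
proof -
  have cr: "\<exists>i k. crossing m p i k" if p: "p \<in> ?P" for p
  proof -
    have "p \<in> involutions (2 * m - 1)" "contains_once (2 * m - 1) p [1, 2, 3]" using p by auto
    then obtain m' i k where "2 * m - 1 = 2 * m' - 1" and cr: "crossing m' p i k"
      by (rule involution_once_crossing)
    moreover have "1 \<le> m'" using cr by (simp add: crossing_def)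
    ultimately have "m' = m" using assms by linarith
    then show ?thesis using cr by blast
  qed
  have "bij_betw (fold_word m) ?P ?W"
    unfolding bij_betw_def
  proof (intro conjI equalityI subsetI)
    show "inj_on (fold_word m) ?P"
      using cr fold_word_inj by (metis (no_types, lifting) inj_onI)
  next
    fix xs assume "xs \<in> fold_word m ` ?P"
    then obtain p i k where p: "p \<in> ?P" "xs = fold_word m p" "crossing m p i k" using cr by blast
    then have "avoids_123 (fold_word m p)"
      using crossing_once_iff[OF p(3)] fold_word_crossing[OF p(3)] by simp
    then show "xs \<in> ?W" using fold_word_mem[OF p(3)] p(2) by simp
  next
    fix xs assume xs: "xs \<in> ?W"
    then obtain p i k where p: "crossing m p i k" "fold_word m p = xs"
      using fold_word_surj assms by blast
    have "avoids_123 (fold_word m p)" using xs p(2) by (simp add: avoiders_def)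
    then have "contains_once (2 * m - 1) p [1, 2, 3]"
      using crossing_once_iff[OF p(1)] fold_word_crossing[OF p(1)] by simp
    then have "p \<in> ?P" using p(1) by (simp add: crossing_def)
    then show "xs \<in> fold_word m ` ?P" using p(2) by blast
  qed
  then show ?thesis by (rule bij_betw_same_card)
qed

text \<open>Absorption and Pascal's rule both express the binomial
  \<open>2 * m + 1 choose Suc (Suc m)\<close> through the two on the left. Twice the former minus
  \<open>2 * m + 1\<close> times the latter is the claim, up to reflecting the lower index to
  \<open>m - 1\<close>; the reflection requires \<open>m\<close> to be positive.\<close>

lemma ballot_3_binomial:
  assumes "0 < m"
  shows "real (2 * m choose Suc m) - real (2 * m choose Suc (Suc m)) =
     3 / real (2 * m + 1) * real (2 * m + 1 choose (m - 1))"
proof -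
  have sym: "(2 * m + 1 choose (m - 1)) = (2 * m + 1 choose Suc (Suc m))"
    using binomial_symmetric[of "m - 1" "2 * m + 1"] assms by (simp add: Suc_diff_le)
  have "Suc (Suc m) * (Suc (2 * m) choose Suc (Suc m)) = Suc (2 * m) * (2 * m choose Suc m)"
    by (rule Suc_times_binomial)
  then have "real (Suc (Suc m)) * real (Suc (2 * m) choose Suc (Suc m)) =
      real (Suc (2 * m)) * real (2 * m choose Suc m)"
    by (metis of_nat_mult)
  moreover have "real (Suc (2 * m) choose Suc (Suc m)) =
      real (2 * m choose Suc m) + real (2 * m choose Suc (Suc m))"
    by simp
  ultimately have "3 * real (Suc (2 * m) choose Suc (Suc m)) =
      real (2 * m + 1) * (real (2 * m choose Suc m) - real (2 * m choose Suc (Suc m)))"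
    by (simp add: algebra_simps del: binomial_Suc_Suc)
  then show ?thesis unfolding sym by (simp add: field_simps del: binomial_Suc_Suc)
qed

theorem theorem3p1:
  fixes n k :: nat
  assumes "n \<ge> 1" and "k \<le> n"
  shows "(k = 3 \<and> n \<ge> 3 \<and> odd n \<longrightarrow>
            real (num_involutions_once n k [1, 2, 3]) =
              3 / real n * real (n choose ((n - 3) div 2)))
       \<and> (\<not> (k = 3 \<and> n \<ge> 3 \<and> odd n) \<longrightarrow>
            num_involutions_once n k [1, 2, 3] = 0)"
proof -
  \<comment> \<open>This settles all vanishing cases at once and, in the remaining case, makes the
    condition on the number of fixed points automatic.\<close>
  have shape: "n \<ge> 3 \<and> odd n \<and> card (fixed_points n p) = 3"
    if p: "p \<in> involutions n" "contains_once n p [1, 2, 3]" for p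
  proof -
    obtain m i l where "n = 2 * m - 1" and cr: "crossing m p i l"
      using involution_once_crossing p by blast
    moreover from cr have "1 \<le> i" "i < m" "m < l" by (auto simp: crossing_def)
    ultimately show ?thesis using crossing_fixed_points[OF cr] by auto
  qed
  show ?thesis
  proof (intro conjI impI)
    assume k: "k = 3 \<and> n \<ge> 3 \<and> odd n"
    \<comment> \<open>This \<open>m\<close> is one less than the centre, so the counting lemma is
      applied at \<open>Suc m\<close>.\<close>
    then obtain m where n: "n = 2 * m + 1" by (blast elim: oddE)
    have "{p \<in> involutions n. card (fixed_points n p) = k \<and> contains_once n p [1, 2, 3]} =
          {p \<in> involutions n. contains_once n p [1, 2, 3]}"
      using shape k by blast
    then have "num_involutions_once n k [1, 2, 3] = card {xs \<in> avoiders (Suc m) 0. xs ! 0 \<noteq> Suc m}"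
      using card_involutions_once_123[of "Suc m"] n by (simp add: num_involutions_once_def)
    then have "real (num_involutions_once n k [1, 2, 3]) =
        real_of_int (int (card {xs \<in> avoiders (Suc m) 0. xs ! 0 \<noteq> Suc m}))" by simp
    also have "\<dots> = 3 / real (2 * m + 1) * real (2 * m + 1 choose (m - 1))"
      using ballot_3_binomial[of m] k n unfolding card_avoiders_hd_not_max by simp
    also have "\<dots> = 3 / real n * real (n choose ((n - 3) div 2))"
    proof -
      have "(n - 3) div 2 = m - 1" using n by simp
      then show ?thesis by (simp only: n)
    qed
    finally show "real (num_involutions_once n k [1, 2, 3]) =
              3 / real n * real (n choose ((n - 3) div 2))" .
  next
    assume "\<not> (k = 3 \<and> n \<ge> 3 \<and> odd n)"
    then have "{p \<in> involutions n. card (fixed_points n p) = k \<and> contains_once n p [1, 2, 3]} = {}"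
      using shape by blast
    then show "num_involutions_once n k [1, 2, 3] = 0" by (simp only: num_involutions_once_def card.empty)
  qed
qed

end
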